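(* Let $\Delta\in(0,1)$. For $\epsilon>0$ and a positive integer $\tau$ consider the two oracle-complexity upper bounds $$E(\epsilon,\tau)=\widetilde{\Theta} \left( (\epsilon^{-3} \tau^{-1} + \epsilon^{-2} \tau^2) \log(1/\Delta) \right),\qquad J(\epsilon,\tau)=\widetilde{\Theta} \left( (\epsilon^{-2} \tau^{-1} + \epsilon^{-1} \tau^2) \log(1/\Delta) \right).$$ The minimal asymptotic rates of $E$ and $J$ with respect to the choice of $\tau$ (as a function of $\epsilon$) are $\widetilde{\Theta} (\epsilon^{-8/3} \log(1/\Delta))$ and $\widetilde{\Theta} (\epsilon^{-5/3} \log(1/\Delta))$ respectively, and they are simultaneously achieved by setting $\tau = \Theta(\epsilon^{-1/3})$.
   Context: Asymptotic notation is with respect to $\epsilon\to0$, and $\widetilde\Theta$ omits multiplicative logarithmic terms in $\epsilon$. Meaning of the quantities: for minimizing $f(g(x))+h(x)$ with $g=\mathbb{E}_{\xi\sim D}[g_\xi]$ by the variance-reduced inexact prox-linear method whose inner loops all have length $\tau$, $E$ and $J$ are the upper bounds (valid when $\tau=O(\epsilon^{-1})$) on the number of evaluations of $g_\xi$ and of Jacobians $g'_\xi$ used to make the average of $\|\mathcal{G}_M\|_2^2$ over the iterates at most $\epsilon$ with probability at least $1-\Delta$, when $g$ and $g'$ are estimated at the $i$-th inner iterate $x_i$ as follows: sample means over large batches at $x_0$ (giving $\widetilde g_0,\widetilde J_0$), and for $i>0$, $\widetilde g_i=\frac1a\sum_{\xi\in\mathcal{A}_i}(g_\xi(x_i)-g_\xi(x_0))+\widetilde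 g_0$, $\widetilde J_i=\frac1b\sum_{\xi\in\mathcal{B}_i}(g'_\xi(x_i)-g'_\xi(x_0))+\widetilde J_0$ with smaller i.i.d. batches $\mathcal{A}_i,\mathcal{B}_i$ of sizes $a,b$. The claim concerns only the two displayed expressions. *)

theory Defs
  imports Complex_Main "HOL-Library.Landau_Symbols"
begin

text \<open>
  Soft asymptotic classes for complexity bounds. The argument \<open>eps\<close> extracts the accuracy
  from the point \<open>x\<close>, so that one definition serves functions of the accuracy alone and functions
  of further parameters: over a product filter with a principal second factor, the constants and
  the threshold are uniform in the second parameter. As usual for complexity bounds, \<open>f\<close> is
  compared without absolute values; for \<open>g\<close> positive, a member of the lower or two-sided class
  is eventually positive.
\<close>

definition soft_bigo :: "('a \<Rightarrow> real) \<Rightarrow> 'a filter \<Rightarrow> ('a \<Rightarrow> real) \<Rightarrow> ('a \<Rightarrow> real) set" where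
  "soft_bigo eps F g =
     {f. \<exists>k::nat. \<exists>C>0. \<forall>\<^sub>F x in F. f x \<le> C * g x * \<bar>ln (eps x)\<bar> ^ k}"

definition soft_bigomega :: "('a \<Rightarrow> real) \<Rightarrow> 'a filter \<Rightarrow> ('a \<Rightarrow> real) \<Rightarrow> ('a \<Rightarrow> real) set" where
  "soft_bigomega eps F g =
     {f. \<exists>k::nat. \<exists>c>0. \<forall>\<^sub>F x in F. c * g x / \<bar>ln (eps x)\<bar> ^ k \<le> f x}"

definition soft_bigtheta :: "('a \<Rightarrow> real) \<Rightarrow> 'a filter \<Rightarrow> ('a \<Rightarrow> real) \<Rightarrow> ('a \<Rightarrow> real) set" where
  "soft_bigtheta eps F g = soft_bigo eps F g \<inter> soft_bigomega eps F g"

definition pos_choice :: "(real \<Rightarrow> nat) \<Rightarrow> bool" where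
  "pos_choice \<tau> \<longleftrightarrow> (\<forall>\<epsilon>>0. \<tau> \<epsilon> > 0)"

text \<open>
  The rate \<open>r\<close> is minimal for the bound \<open>T \<epsilon> \<tau>\<close> if some choice of \<open>\<tau>\<close> as a function of \<open>\<epsilon>\<close>
  attains it and no choice does better, up to logarithmic factors.
\<close>

definition minimal_soft_rate :: "(real \<Rightarrow> nat \<Rightarrow> real) \<Rightarrow> (real \<Rightarrow> real) \<Rightarrow> bool" where
  "minimal_soft_rate T r \<longleftrightarrow>
     (\<exists>\<tau>. pos_choice \<tau> \<and> (\<lambda>\<epsilon>. T \<epsilon> (\<tau> \<epsilon>)) \<in> soft_bigtheta (\<lambda>\<epsilon>. \<epsilon>) (at_right 0) r) \<and>
     (\<forall>\<tau>. pos_choice \<tau> \<longrightarrow> (\<lambda>\<epsilon>. T \<epsilon> (\<tau> \<epsilon>)) \<in> soft_bigomega (\<lambda>\<epsilon>. \<epsilon>) (at_right 0) r)"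

end

theory Submission
  imports Defs
begin

text \<open>
  Put \<open>u = \<tau> \<epsilon>\<^sup>1\<^sup>/\<^sup>3\<close>. Then \<open>\<epsilon>\<^sup>p \<tau>\<^sup>-\<^sup>1 + \<epsilon>\<^sup>p\<^sup>+\<^sup>1 \<tau>\<^sup>2 = \<epsilon>\<^sup>p\<^sup>+\<^sup>1\<^sup>/\<^sup>3 (1 / u + u\<^sup>2)\<close>, so both bounds (\<open>p = -3\<close> and \<open>p = -2\<close>)
  are governed by the same function of \<open>u\<close>. It is at least \<open>1\<close> for every \<open>u > 0\<close>, and it is bounded
  when \<open>u\<close> stays between two positive constants, that is, when \<open>\<tau>\<close> is of order \<open>\<epsilon>\<^sup>-\<^sup>1\<^sup>/\<^sup>3\<close>.
\<close>

text \<open>Used with \<open>h\<close> sending \<open>\<epsilon>\<close> to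
  \<open>(\<epsilon>, \<tau> \<epsilon>)\<close>: a bound uniform in the inner length becomes a
  bound along one choice of it, with the same constant and power of the logarithm.\<close>

lemma soft_bigo_compose:
  assumes "f \<in> soft_bigo eps F g" and "filterlim h F G"
  shows "(\<lambda>x. f (h x)) \<in> soft_bigo (\<lambda>x. eps (h x)) G (\<lambda>x. g (h x))"
proof -
  from assms(1) obtain k and C :: real where "C > 0"
    and "\<forall>\<^sub>F x in F. f x \<le> C * g x * \<bar>ln (eps x)\<bar> ^ k"
    by (auto simp: soft_bigo_def)
  with assms(2) show ?thesis
    unfolding soft_bigo_def filterlim_iff by blast
qed

lemma soft_bigomega_compose:
  assumes "f \<in> soft_bigomega eps F g" and "filterlim h F G"
  shows "(\<lambda>x. f (h x)) \<in> soft_bigomega (\<lambda>x. eps (h x)) G (\<lambda>x. g (h x))"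
proof -
  from assms(1) obtain k and c :: real where "c > 0"
    and "\<forall>\<^sub>F x in F. c * g x / \<bar>ln (eps x)\<bar> ^ k \<le> f x"
    by (auto simp: soft_bigomega_def)
  with assms(2) show ?thesis
    unfolding soft_bigomega_def filterlim_iff by blast
qed

text \<open>\<open>K\<close> is absorbed into the constant. The power of the logarithm is
  nonnegative, so multiplying by it preserves the comparison whatever the signs of \<open>g\<close>
  and \<open>g'\<close>.\<close>

lemma soft_bigo_mono:
  assumes f: "f \<in> soft_bigo eps F g"
    and "K > 0" and gg': "\<forall>\<^sub>F x in F. g x \<le> K * g' x"
  shows "f \<in> soft_bigo eps F g'"
proof -
  from f obtain k C where C: "C > 0"
    and le: "\<forall>\<^sub>F x in F. f x \<le> C * g x * \<bar>ln (eps x)\<bar> ^ k"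
    by (auto simp: soft_bigo_def)
  from le gg' have "\<forall>\<^sub>F x in F. f x \<le> (C * K) * g' x * \<bar>ln (eps x)\<bar> ^ k"
  proof eventually_elim
    case (elim x)
    have "C * g x \<le> C * (K * g' x)"
      using C elim(2) by (intro mult_left_mono) auto
    then have "C * g x * \<bar>ln (eps x)\<bar> ^ k \<le> C * (K * g' x) * \<bar>ln (eps x)\<bar> ^ k"
      by (intro mult_right_mono) auto
    with elim(1) show ?case by (simp add: mult.assoc)
  qed
  with C \<open>K > 0\<close> show ?thesis
    unfolding soft_bigo_def by (blast intro: mult_pos_pos)
qed

lemma soft_bigomega_mono:
  assumes f: "f \<in> soft_bigomega eps F g"
    and "K > 0" and gg': "\<forall>\<^sub>F x in F. K * g' x \<le> g x"
  shows "f \<in> soft_bigomega eps F g'"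
proof -
  from f obtain k c where c: "c > 0"
    and le: "\<forall>\<^sub>F x in F. c * g x / \<bar>ln (eps x)\<bar> ^ k \<le> f x"
    by (auto simp: soft_bigomega_def)
  from le gg' have "\<forall>\<^sub>F x in F. (c * K) * g' x / \<bar>ln (eps x)\<bar> ^ k \<le> f x"
  proof eventually_elim
    case (elim x)
    have "c * (K * g' x) \<le> c * g x"
      using c elim(2) by (intro mult_left_mono) auto
    \<comment> \<open>Where the logarithm vanishes and \<open>k > 0\<close>, both quotients are 0 by
      convention, so a nonnegative denominator suffices.\<close>
    then have "c * (K * g' x) / \<bar>ln (eps x)\<bar> ^ k \<le> c * g x / \<bar>ln (eps x)\<bar> ^ k"
      by (intro divide_right_mono) auto
    with elim(1) show ?case by (simp add: mult.assoc)
  qed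
  with c \<open>K > 0\<close> show ?thesis
    unfolding soft_bigomega_def by (blast intro: mult_pos_pos)
qed

text \<open>The principal factor asks only for \<open>\<tau> \<epsilon> \<ge> 1\<close>, with no
  condition on growth, so every admissible choice can be substituted into the uniform
  bounds.\<close>

lemma filterlim_pos_choice:
  assumes "pos_choice \<tau>"
  shows "filterlim (\<lambda>\<epsilon>. (\<epsilon>, \<tau> \<epsilon>)) (at_right 0 \<times>\<^sub>F principal {1..}) (at_right 0)"
proof (rule filterlim_Pair)
  have "\<forall>\<^sub>F \<epsilon> in at_right 0. \<tau> \<epsilon> \<in> {1..}"
    using assms eventually_at_right_less[of "0::real"]
    by (auto simp: pos_choice_def Suc_le_eq elim!: eventually_mono)
  then show "filterlim \<tau> (principal {1..}) (at_right 0)"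
    by (simp add: filterlim_principal)
qed (rule filterlim_ident)

text \<open>One summand alone suffices: \<open>1 / u\<close> when \<open>u \<le> 1\<close>, and the
  square otherwise.\<close>

lemma one_le_inverse_plus_square:
  fixes u :: real
  assumes "u > 0"
  shows "1 \<le> 1 / u + u\<^sup>2"
proof (cases "u \<le> 1")
  case True
  with assms have "1 \<le> 1 / u" by simp
  then show ?thesis by (simp add: add_increasing2)
next
  case False
  then have "1 \<le> u\<^sup>2" by (simp add: one_le_power)
  with assms show ?thesis by (simp add: add_increasing)
qed

text \<open>The exponent 1/3 solves \<open>p + s = p + 1 - 2 * s\<close>, so it is the scaling of
  \<open>t\<close> that gives both summands the same power of \<open>\<epsilon>\<close> as a
  factor.\<close>

lemma inner_length_rescale:
  fixes \<epsilon> t p :: real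
  assumes "\<epsilon> > 0" and "t > 0"
  shows "\<epsilon> powr p * t powr (-1) + \<epsilon> powr (p + 1) * t ^ 2 =
    \<epsilon> powr (p + 1/3) * (1 / (t * \<epsilon> powr (1/3)) + (t * \<epsilon> powr (1/3))\<^sup>2)"
proof -
  have "(\<epsilon> powr (1/3))\<^sup>2 = \<epsilon> powr (2/3)"
    using assms by (simp add: powr_power)
  moreover have "\<epsilon> powr (p + 1) = \<epsilon> powr (p + 1/3) * \<epsilon> powr (2/3)"
    by (simp add: add.commute flip: powr_add)
  moreover have "\<epsilon> powr (p + 1/3) = \<epsilon> powr p * \<epsilon> powr (1/3)"
    by (rule powr_add)
  ultimately show ?thesis
    using assms by (simp add: powr_minus_divide field_simps)
qed

text \<open>A common form of the two complexity bounds: \<open>p = -3\<close> gives \<open>E\<close>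
  and \<open>p = -2\<close> gives \<open>J\<close>, while \<open>L\<close> stands for
  \<open>ln (1 / \<Delta>)\<close>.\<close>

context
  fixes T :: "real \<Rightarrow> nat \<Rightarrow> real" and p L :: real
  assumes L: "L > 0"
    and T: "(\<lambda>(\<epsilon>, \<tau>). T \<epsilon> \<tau>) \<in> soft_bigtheta fst (at_right 0 \<times>\<^sub>F principal {1..})
      (\<lambda>(\<epsilon>, \<tau>). (\<epsilon> powr p * real \<tau> powr (-1) + \<epsilon> powr (p + 1) * real \<tau> ^ 2) * L)"
begin

text \<open>Holds for any growth of \<open>\<tau>\<close>, since after rescaling the remaining
  factor is at least 1 at every positive argument.\<close>

lemma inner_length_soft_bigomega:
  assumes \<tau>: "pos_choice \<tau>"
  shows "(\<lambda>\<epsilon>. T \<epsilon> (\<tau> \<epsilon>)) \<in>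
    soft_bigomega (\<lambda>\<epsilon>. \<epsilon>) (at_right 0) (\<lambda>\<epsilon>. \<epsilon> powr (p + 1/3) * L)"
proof (rule soft_bigomega_mono[where K = 1])
  show "(\<lambda>\<epsilon>. T \<epsilon> (\<tau> \<epsilon>)) \<in> soft_bigomega (\<lambda>\<epsilon>. \<epsilon>) (at_right 0)
      (\<lambda>\<epsilon>. (\<epsilon> powr p * real (\<tau> \<epsilon>) powr (-1) + \<epsilon> powr (p + 1) * real (\<tau> \<epsilon>) ^ 2) * L)"
    using T soft_bigomega_compose[OF _ filterlim_pos_choice[OF \<tau>]]
    by (force simp: soft_bigtheta_def)
  show "\<forall>\<^sub>F \<epsilon> in at_right 0. 1 * (\<epsilon> powr (p + 1/3) * L) \<le>
      (\<epsilon> powr p * real (\<tau> \<epsilon>) powr (-1) + \<epsilon> powr (p + 1) * real (\<tau> \<epsilon>) ^ 2) * L"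
    using eventually_at_right_less[of "0::real"]
  proof eventually_elim
    case (elim \<epsilon>)
    with \<tau> have pos: "real (\<tau> \<epsilon>) > 0" by (simp add: pos_choice_def)
    have "\<epsilon> powr (p + 1/3) * 1 \<le> \<epsilon> powr (p + 1/3) *
        (1 / (real (\<tau> \<epsilon>) * \<epsilon> powr (1/3)) + (real (\<tau> \<epsilon>) * \<epsilon> powr (1/3))\<^sup>2)"
      using elim pos by (intro mult_left_mono one_le_inverse_plus_square) auto
    with L show ?case
      unfolding inner_length_rescale[OF elim pos] by (simp add: mult_right_mono)
  qed
qed simp

text \<open>Both halves of the order of \<open>\<tau>\<close> matter: the lower one controls
  \<open>1 / u\<close>, the upper one controls the square of \<open>u\<close>.\<close>

lemma inner_length_soft_bigo:
  assumes \<tau>: "pos_choice \<tau>"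
    and \<Theta>: "(\<lambda>\<epsilon>. real (\<tau> \<epsilon>)) \<in> \<Theta>[at_right 0](\<lambda>\<epsilon>. \<epsilon> powr (-1/3))"
  shows "(\<lambda>\<epsilon>. T \<epsilon> (\<tau> \<epsilon>)) \<in>
    soft_bigo (\<lambda>\<epsilon>. \<epsilon>) (at_right 0) (\<lambda>\<epsilon>. \<epsilon> powr (p + 1/3) * L)"
proof -
  from \<Theta> obtain C where C: "C > 0"
    and upper: "\<forall>\<^sub>F \<epsilon> in at_right 0. real (\<tau> \<epsilon>) \<le> C * \<epsilon> powr (-1/3)"
    by (auto dest!: bigthetaD1 elim!: landau_o.bigE)
  from \<Theta> obtain c where c: "c > 0"
    and lower: "\<forall>\<^sub>F \<epsilon> in at_right 0. c * \<epsilon> powr (-1/3) \<le> real (\<tau> \<epsilon>)"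
    by (auto dest!: bigthetaD2 elim!: landau_omega.bigE)
  show ?thesis
  \<comment> \<open>\<open>K\<close> bounds \<open>1 / u + u\<^sup>2\<close> on the interval from
    \<open>c\<close> to \<open>C\<close>, where the rescaled length \<open>u\<close> eventually
    lies.\<close>
  proof (rule soft_bigo_mono[where K = "1 / c + C\<^sup>2"])
    show "(\<lambda>\<epsilon>. T \<epsilon> (\<tau> \<epsilon>)) \<in> soft_bigo (\<lambda>\<epsilon>. \<epsilon>) (at_right 0)
        (\<lambda>\<epsilon>. (\<epsilon> powr p * real (\<tau> \<epsilon>) powr (-1) + \<epsilon> powr (p + 1) * real (\<tau> \<epsilon>) ^ 2) * L)"
      using T soft_bigo_compose[OF _ filterlim_pos_choice[OF \<tau>]]
      by (force simp: soft_bigtheta_def)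
    show "1 / c + C\<^sup>2 > 0" using c by (simp add: add_pos_nonneg)
    show "\<forall>\<^sub>F \<epsilon> in at_right 0.
        (\<epsilon> powr p * real (\<tau> \<epsilon>) powr (-1) + \<epsilon> powr (p + 1) * real (\<tau> \<epsilon>) ^ 2) * L \<le>
        (1 / c + C\<^sup>2) * (\<epsilon> powr (p + 1/3) * L)"
      using eventually_at_right_less[of "0::real"] upper lower
    proof eventually_elim
      case (elim \<epsilon>)
      with \<tau> have pos: "real (\<tau> \<epsilon>) > 0" by (simp add: pos_choice_def)
      define u where "u = real (\<tau> \<epsilon>) * \<epsilon> powr (1/3)"
      have cancel: "\<epsilon> powr (-1/3) * \<epsilon> powr (1/3) = 1"
        using elim(1) by (simp flip: powr_add)
      have "u \<le> C * \<epsilon> powr (-1/3) * \<epsilon> powr (1/3)"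
        unfolding u_def using elim(2) by (intro mult_right_mono) auto
      with cancel have "u \<le> C" by (simp add: mult.assoc)
      moreover have "c * \<epsilon> powr (-1/3) * \<epsilon> powr (1/3) \<le> u"
        unfolding u_def using elim(3) by (intro mult_right_mono) auto
      with cancel have "c \<le> u" by (simp add: mult.assoc)
      ultimately have "1 / u + u\<^sup>2 \<le> 1 / c + C\<^sup>2"
        using c by (intro add_mono power_mono divide_left_mono) auto
      then have "\<epsilon> powr (p + 1/3) * (1 / u + u\<^sup>2) * L \<le> \<epsilon> powr (p + 1/3) * (1 / c + C\<^sup>2) * L"
        using L by (intro mult_right_mono mult_left_mono) auto
      then show ?case
        unfolding inner_length_rescale[OF elim(1) pos] u_def by (simp add: mult_ac)
    qed
  qed
qed

lemma inner_length_soft_bigtheta: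
  assumes "pos_choice \<tau>"
    and "(\<lambda>\<epsilon>. real (\<tau> \<epsilon>)) \<in> \<Theta>[at_right 0](\<lambda>\<epsilon>. \<epsilon> powr (-1/3))"
  shows "(\<lambda>\<epsilon>. T \<epsilon> (\<tau> \<epsilon>)) \<in>
    soft_bigtheta (\<lambda>\<epsilon>. \<epsilon>) (at_right 0) (\<lambda>\<epsilon>. \<epsilon> powr (p + 1/3) * L)"
  using assms inner_length_soft_bigo inner_length_soft_bigomega
  by (auto simp: soft_bigtheta_def)

end

text \<open>Rounding up keeps the length positive even where the power is below 1.\<close>

lemma pos_choice_nat_ceiling_powr:
  "pos_choice (\<lambda>\<epsilon>. nat \<lceil>\<epsilon> powr a\<rceil>)"
  by (simp add: pos_choice_def)

text \<open>For \<open>\<epsilon> < 1\<close> and \<open>a \<le> 0\<close> the power is at least 1,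
  so rounding up, which adds less than 1, at most doubles it. This gives the constants 1 and
  2.\<close>

lemma nat_ceiling_powr_bigtheta:
  assumes "a \<le> 0"
  shows "(\<lambda>\<epsilon>. real (nat \<lceil>\<epsilon> powr a\<rceil>)) \<in> \<Theta>[at_right 0](\<lambda>\<epsilon>::real. \<epsilon> powr a)"
proof (rule bigthetaI')
  have "\<forall>\<^sub>F \<epsilon> in at_right (0::real). \<epsilon> \<in> {0<..<1}"
    by (rule eventually_at_right_real) simp
  then show "\<forall>\<^sub>F \<epsilon> in at_right (0::real).
      1 * norm (\<epsilon> powr a) \<le> norm (real (nat \<lceil>\<epsilon> powr a\<rceil>)) \<and>
      norm (real (nat \<lceil>\<epsilon> powr a\<rceil>)) \<le> 2 * norm (\<epsilon> powr a)"
  proof eventually_elim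
    case (elim \<epsilon>)
    then have "1 \<le> \<epsilon> powr a"
      using powr_mono2'[of a \<epsilon> 1] assms by simp
    moreover have "real (nat \<lceil>\<epsilon> powr a\<rceil>) = of_int \<lceil>\<epsilon> powr a\<rceil>"
      using calculation by (intro of_nat_nat) linarith
    ultimately show ?case
      using ceiling_correct[of "\<epsilon> powr a"] by simp
  qed
qed simp_all

theorem corollary3p8:
  fixes \<Delta> :: real and E J :: "real \<Rightarrow> nat \<Rightarrow> real"
  assumes "0 < \<Delta>" and "\<Delta> < 1"
    and "(\<lambda>(\<epsilon>, \<tau>). E \<epsilon> \<tau>) \<in> soft_bigtheta fst (at_right 0 \<times>\<^sub>F principal {1..})
           (\<lambda>(\<epsilon>, \<tau>). (\<epsilon> powr (-3) * real \<tau> powr (-1) + \<epsilon> powr (-2) * real \<tau> ^ 2) * ln (1 / \<Delta>))"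
    and "(\<lambda>(\<epsilon>, \<tau>). J \<epsilon> \<tau>) \<in> soft_bigtheta fst (at_right 0 \<times>\<^sub>F principal {1..})
           (\<lambda>(\<epsilon>, \<tau>). (\<epsilon> powr (-2) * real \<tau> powr (-1) + \<epsilon> powr (-1) * real \<tau> ^ 2) * ln (1 / \<Delta>))"
  shows "minimal_soft_rate E (\<lambda>\<epsilon>. \<epsilon> powr (-8/3) * ln (1 / \<Delta>)) \<and>
    minimal_soft_rate J (\<lambda>\<epsilon>. \<epsilon> powr (-5/3) * ln (1 / \<Delta>)) \<and>
    (\<exists>\<tau>. pos_choice \<tau> \<and> (\<lambda>\<epsilon>. real (\<tau> \<epsilon>)) \<in> \<Theta>[at_right 0](\<lambda>\<epsilon>. \<epsilon> powr (-1/3))) \<and>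
    (\<forall>\<tau>. pos_choice \<tau> \<and> (\<lambda>\<epsilon>. real (\<tau> \<epsilon>)) \<in> \<Theta>[at_right 0](\<lambda>\<epsilon>. \<epsilon> powr (-1/3)) \<longrightarrow>
      (\<lambda>\<epsilon>. E \<epsilon> (\<tau> \<epsilon>)) \<in> soft_bigtheta (\<lambda>\<epsilon>. \<epsilon>) (at_right 0) (\<lambda>\<epsilon>. \<epsilon> powr (-8/3) * ln (1 / \<Delta>)) \<and>
      (\<lambda>\<epsilon>. J \<epsilon> (\<tau> \<epsilon>)) \<in> soft_bigtheta (\<lambda>\<epsilon>. \<epsilon>) (at_right 0) (\<lambda>\<epsilon>. \<epsilon> powr (-5/3) * ln (1 / \<Delta>)))"
proof -
  have L: "ln (1 / \<Delta>) > 0"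
    using assms(1,2) by (intro ln_gt_zero) simp
  have E_omega: "(\<lambda>\<epsilon>. E \<epsilon> (\<tau> \<epsilon>)) \<in> soft_bigomega (\<lambda>\<epsilon>. \<epsilon>) (at_right 0) (\<lambda>\<epsilon>. \<epsilon> powr (-8/3) * ln (1 / \<Delta>))"
    if "pos_choice \<tau>" for \<tau>
    \<comment> \<open>Here \<open>p + 1/3\<close> is -8/3; for \<open>J\<close>, with
      \<open>p = -2\<close>, it is -5/3.\<close>
    using inner_length_soft_bigomega[OF L, of E "-3"] assms(3) that by simp
  have J_omega: "(\<lambda>\<epsilon>. J \<epsilon> (\<tau> \<epsilon>)) \<in> soft_bigomega (\<lambda>\<epsilon>. \<epsilon>) (at_right 0) (\<lambda>\<epsilon>. \<epsilon> powr (-5/3) * ln (1 / \<Delta>))"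
    if "pos_choice \<tau>" for \<tau>
    using inner_length_soft_bigomega[OF L, of J "-2"] assms(4) that by simp
  have E_theta: "(\<lambda>\<epsilon>. E \<epsilon> (\<tau> \<epsilon>)) \<in> soft_bigtheta (\<lambda>\<epsilon>. \<epsilon>) (at_right 0) (\<lambda>\<epsilon>. \<epsilon> powr (-8/3) * ln (1 / \<Delta>))"
    if "pos_choice \<tau>" "(\<lambda>\<epsilon>. real (\<tau> \<epsilon>)) \<in> \<Theta>[at_right 0](\<lambda>\<epsilon>. \<epsilon> powr (-1/3))" for \<tau>
    using inner_length_soft_bigtheta[OF L, of E "-3"] assms(3) that by simp
  have J_theta: "(\<lambda>\<epsilon>. J \<epsilon> (\<tau> \<epsilon>)) \<in> soft_bigtheta (\<lambda>\<epsilon>. \<epsilon>) (at_right 0) (\<lambda>\<epsilon>. \<epsilon> powr (-5/3) * ln (1 / \<Delta>))"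
    if "pos_choice \<tau>" "(\<lambda>\<epsilon>. real (\<tau> \<epsilon>)) \<in> \<Theta>[at_right 0](\<lambda>\<epsilon>. \<epsilon> powr (-1/3))" for \<tau>
    using inner_length_soft_bigtheta[OF L, of J "-2"] assms(4) that by simp
  \<comment> \<open>The witness is the ceiling of \<open>\<epsilon> powr (-1/3)\<close>; it attains
    both minimal rates at once.\<close>
  have \<tau>: "\<exists>\<tau>. pos_choice \<tau> \<and> (\<lambda>\<epsilon>. real (\<tau> \<epsilon>)) \<in> \<Theta>[at_right 0](\<lambda>\<epsilon>. \<epsilon> powr (-1/3))"
    using pos_choice_nat_ceiling_powr[of "-1/3"] nat_ceiling_powr_bigtheta[of "-1/3"] by auto
  show ?thesis
    unfolding minimal_soft_rate_def
    using \<tau> E_omega J_omega E_theta J_theta by blast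
qed

end
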